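(* Let $G$ be a connected graph and let $S$ be any minimal vertex separator of $G$. Let $G_1, G_2, \ldots, G_l$ ($l \ge 2$) be the connected components of $G\setminus S$. Then $G$ is $2K_2$-free if and only if it satisfies the following conditions: (i) $G\setminus S$ contains at most one non-trivial component. Further, if $G\setminus S$ has a non-trivial component, say $G_1$, then the subgraph induced on $V(G_1)\cup S$ does not contain $H_1$, $H_2$, $H_3$ as induced subgraphs. (ii) Every trivial component of $G\setminus S$ is universal to $S$ (i.e. its unique vertex is universal to $S$). (iii) Every edge in the non-trivial component of $G\setminus S$ is universal to $S$. (iv) The subgraph induced on $S$ is either connected or has at most one non-trivial component. Further, if the subgraph induced on $S$ has a non-trivial component, say $S_1$, then the subgraph induced on $V(S_1)$ does not contain $H_1$, $H_2$, $H_3$ as induced subgraphs. (v) If $S$ (i.e. the subgraph induced on $S$) and $G\setminus S$ have a non-trivial component, say $S_1$ and $G_1$ respectively, then every edge $e=\{u,v\}$ in $S_1$ is universal to $M$, where $M = \{x \in V(G_1) \mid \{x,y\}\in E(G)\ \ \forall\, y \in S\setminus (N_G(u)\cup N_G(v))\}$.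
   Context: Graphs are finite, simple and undirected. A graph is $2K_2$-free if it has no two edges $\{a,b\},\{c,d\}$ on four distinct vertices with $\{a,c\},\{a,d\},\{b,c\},\{b,d\}\notin E(G)$. For $S\subseteq V(G)$, $G\setminus S$ is the subgraph induced on $V(G)\setminus S$. A vertex separator is a set $R\subset V(G)$ such that $G\setminus R$ has at least two connected components; it is a minimal vertex separator if no proper subset of $R$ is a vertex separator. A connected component is trivial if it has exactly one vertex and non-trivial if it has at least two vertices. $N_G(v)$ is the set of neighbours of $v$. A vertex $v$ is universal to a vertex set $X$ (with $v\notin X$) if $v$ is adjacent to every vertex of $X$. An edge $\{u,v\}$ is universal to a vertex set $X$ if every $x\in X$ is adjacent to $u$ or to $v$ (or both). $H_1,H_2,H_3$ are graphs on $\{1,2,3,4,5\}$: $H_1$ is the path $P_5$ with edges $12,23,34,45$; $H_2$ is a triangle with a pendant path of length two, with edges $12,13,23,34,45$; $H_3$ is the butterfly (two triangles sharing one vertex), with edges $12,13,23,34,35,45$.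
   Formalization: Condition (v) is required only for edges {u,v} of S_1 with S \ (N_G(u) ∪ N_G(v)) nonempty; if that set is empty then M = V(G_1) and the claim fails, e.g. for edges tu, tv, uv, zu, zv, zx with S = {u,v}. *)

theory Defs
  imports "Graph_Theory.Graph_Theory"
begin

text \<open>
  A finite simple undirected graph is represented by the locale \<open>graph\<close>: a finite symmetric
  digraph without loops and parallel arcs. An edge \<open>{u, v}\<close> corresponds to the pair of opposite
  arcs between \<open>u\<close> and \<open>v\<close>, and adjacency is \<open>u \<rightarrow>\<^bsub>G\<^esub> v\<close>.
\<close>

definition neighbours :: "('a, 'b) pre_digraph \<Rightarrow> 'a \<Rightarrow> 'a set" where
  "neighbours G v = {w. v \<rightarrow>\<^bsub>G\<^esub> w}"

definition two_K2_free :: "('a, 'b) pre_digraph \<Rightarrow> bool" where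
  "two_K2_free G \<longleftrightarrow>
     \<not> (\<exists>a b c d. distinct [a, b, c, d] \<and> a \<rightarrow>\<^bsub>G\<^esub> b \<and> c \<rightarrow>\<^bsub>G\<^esub> d \<and>
          \<not> a \<rightarrow>\<^bsub>G\<^esub> c \<and> \<not> a \<rightarrow>\<^bsub>G\<^esub> d \<and> \<not> b \<rightarrow>\<^bsub>G\<^esub> c \<and> \<not> b \<rightarrow>\<^bsub>G\<^esub> d)"

definition delete_verts :: "('a, 'b) pre_digraph \<Rightarrow> 'a set \<Rightarrow> ('a, 'b) pre_digraph" where
  "delete_verts G S = G \<restriction> (verts G - S)"

text \<open>
  In a symmetric digraph the strongly connected components are the connected components of the
  underlying undirected graph.
\<close>

abbreviation components :: "('a, 'b) pre_digraph \<Rightarrow> ('a, 'b) pre_digraph set" where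
  "components G \<equiv> pre_digraph.sccs G"

definition trivial_component :: "('a, 'b) pre_digraph \<Rightarrow> ('a, 'b) pre_digraph \<Rightarrow> bool" where
  "trivial_component C G \<longleftrightarrow> C \<in> components G \<and> card (verts C) = 1"

definition nontrivial_component :: "('a, 'b) pre_digraph \<Rightarrow> ('a, 'b) pre_digraph \<Rightarrow> bool" where
  "nontrivial_component C G \<longleftrightarrow> C \<in> components G \<and> card (verts C) \<ge> 2"

definition at_most_one_nontrivial_component :: "('a, 'b) pre_digraph \<Rightarrow> bool" where
  "at_most_one_nontrivial_component G \<longleftrightarrow>
     (\<forall>C D. nontrivial_component C G \<and> nontrivial_component D G \<longrightarrow> C = D)"

definition vertex_separator :: "('a, 'b) pre_digraph \<Rightarrow> 'a set \<Rightarrow> bool" where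
  "vertex_separator G R \<longleftrightarrow> R \<subseteq> verts G \<and> card (components (delete_verts G R)) \<ge> 2"

definition minimal_vertex_separator :: "('a, 'b) pre_digraph \<Rightarrow> 'a set \<Rightarrow> bool" where
  "minimal_vertex_separator G R \<longleftrightarrow>
     vertex_separator G R \<and> (\<forall>R'. R' \<subset> R \<longrightarrow> \<not> vertex_separator G R')"

definition vertex_universal :: "('a, 'b) pre_digraph \<Rightarrow> 'a \<Rightarrow> 'a set \<Rightarrow> bool" where
  "vertex_universal G v X \<longleftrightarrow> v \<notin> X \<and> (\<forall>x\<in>X. v \<rightarrow>\<^bsub>G\<^esub> x)"

definition edge_universal :: "('a, 'b) pre_digraph \<Rightarrow> 'a \<Rightarrow> 'a \<Rightarrow> 'a set \<Rightarrow> bool" where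
  "edge_universal G u v X \<longleftrightarrow> (\<forall>x\<in>X. x \<rightarrow>\<^bsub>G\<^esub> u \<or> x \<rightarrow>\<^bsub>G\<^esub> v)"

definition contains_induced ::
    "('a, 'b) pre_digraph \<Rightarrow> ('c, 'd) pre_digraph \<Rightarrow> bool" where
  "contains_induced G H \<longleftrightarrow> (\<exists>K. induced_subgraph K G \<and> digraph_iso H K)"

definition sym_graph :: "nat set \<Rightarrow> (nat \<times> nat) set \<Rightarrow> (nat, nat \<times> nat) pre_digraph" where
  "sym_graph V E = with_proj \<lparr> pverts = V, parcs = E \<union> E\<inverse> \<rparr>"

definition H1 :: "(nat, nat \<times> nat) pre_digraph" where
  "H1 = sym_graph {1, 2, 3, 4, 5} {(1, 2), (2, 3), (3, 4), (4, 5)}"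

definition H2 :: "(nat, nat \<times> nat) pre_digraph" where
  "H2 = sym_graph {1, 2, 3, 4, 5} {(1, 2), (1, 3), (2, 3), (3, 4), (4, 5)}"

definition H3 :: "(nat, nat \<times> nat) pre_digraph" where
  "H3 = sym_graph {1, 2, 3, 4, 5} {(1, 2), (1, 3), (2, 3), (3, 4), (3, 5), (4, 5)}"

definition H_free :: "('a, 'b) pre_digraph \<Rightarrow> bool" where
  "H_free G \<longleftrightarrow>
     \<not> contains_induced G H1 \<and> \<not> contains_induced G H2 \<and> \<not> contains_induced G H3"

text \<open>
  The vertices of \<open>W\<close> adjacent to every vertex of \<open>S\<close> that is adjacent to neither \<open>u\<close> nor \<open>v\<close>.
  If \<open>u\<close> and \<open>v\<close> together dominate \<open>S\<close>, the condition is void and the set is all of \<open>W\<close>; an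
  edge \<open>{u, v}\<close> of a 2K2-free graph need not be universal to it then. For example, the graph on
  \<open>t, u, v, z, x\<close> with edges \<open>tu, tv, uv, zu, zv, zx\<close> is connected and 2K2-free and has the
  minimal vertex separator \<open>S = {u, v}\<close>, whose removal leaves the components \<open>{t}\<close> and \<open>{x, z}\<close>;
  the set for \<open>W = {x, z}\<close> contains \<open>x\<close>, which is adjacent to neither \<open>u\<close> nor \<open>v\<close>. Universality
  of \<open>{u, v}\<close> to this set is therefore only demanded when \<open>S - (N(u) \<union> N(v))\<close> is nonempty.
\<close>

definition M_set ::
    "('a, 'b) pre_digraph \<Rightarrow> 'a set \<Rightarrow> 'a set \<Rightarrow> 'a \<Rightarrow> 'a \<Rightarrow> 'a set" where
  "M_set G W S u v = {x \<in> W. \<forall>y \<in> S - (neighbours G u \<union> neighbours G v). x \<rightarrow>\<^bsub>G\<^esub> y}"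

end

theory Submission
  imports Defs
begin

text \<open>
  Two facts carry the proof.

  The first is that a connected graph is $2K_2$-free exactly when it contains none of \<open>H1\<close>, \<open>H2\<close>,
  \<open>H3\<close>. The edges \<open>12\<close> and \<open>45\<close> form a $2K_2$ in each of the three. Conversely, given an induced
  $2K_2$ in a connected graph, follow a walk from one of its edges to the other, replacing the first
  edge by the edge just walked along, until a vertex \<open>x\<close> is met that sees both edges. The two edges
  and \<open>x\<close> then induce a path, a triangle with a pendant path or a butterfly, depending on how many
  ends of each edge \<open>x\<close> sees (\<open>not_H_free_if_reachable_2K2\<close>).

  The second is that every vertex of a minimal vertex separator \<open>S\<close> has a neighbour in every component
  of \<open>G - S\<close>, since otherwise it could be put back without connecting that component to the others
  (\<open>component_has_neighbour\<close>). Hence a trivial component is universal to \<open>S\<close>, the graph induced on a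
  component together with \<open>S\<close> is connected, and a vertex of \<open>S\<close> missed by an edge of one component
  forms a $2K_2$ with that edge and a neighbour in another component.

  If \<open>G\<close> is $2K_2$-free, each condition follows by exhibiting the $2K_2$ that its failure would create.
  For the converse, suppose that the conditions hold and take an induced $2K_2$. If it used the vertex
  of a trivial component, the edge at that vertex would end in \<open>S\<close>; universality would keep the other
  edge out of \<open>S\<close>, hence in the non-trivial component, and that edge would be universal to \<open>S\<close>. So the
  $2K_2$ lies in \<open>S\<close> together with the non-trivial component, a connected graph without \<open>H1\<close>, \<open>H2\<close>,
  \<open>H3\<close>; or, when all components are trivial, in the non-trivial component of \<open>S\<close>, another such graph.
\<close>

section \<open>Adjacency in induced subgraphs and in components\<close>

lemma dominates_induce_iff:
  "u \<rightarrow>\<^bsub>G \<restriction> X\<^esub> v \<longleftrightarrow> u \<in> X \<and> v \<in> X \<and> u \<rightarrow>\<^bsub>G\<^esub> v"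
  by (auto simp: arcs_ends_conv)

lemma dominates_induced_iff:
  assumes "induced_subgraph K G"
  shows "u \<rightarrow>\<^bsub>K\<^esub> v \<longleftrightarrow> u \<in> verts K \<and> v \<in> verts K \<and> u \<rightarrow>\<^bsub>G\<^esub> v"
proof -
  have "wf_digraph G"
    using assms by (auto simp: induced_subgraph_def subgraph_def)
  then have "G \<restriction> verts K = K"
    using assms by (rule wf_digraph.induce_eq_iff_induced)
  then show ?thesis
    using dominates_induce_iff by metis
qed

lemma induce_induce: "Y \<subseteq> X \<Longrightarrow> (G \<restriction> X) \<restriction> Y = G \<restriction> Y"
  by (auto simp: induce_subgraph_def)

lemma graph_induce:
  assumes "graph G" and "X \<subseteq> verts G"
  shows "graph (G \<restriction> X)"
proof -
  interpret graph G by fact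
  have ind: "induced_subgraph (G \<restriction> X) G"
    using assms(2) by (rule induced_induce)
  show ?thesis
    using digraph.graphI[OF digraphI_induced[OF ind]]
      induced_graph_imp_symmetric[OF sym_arcs ind] by blast
qed

context graph
begin

lemma dominates_sym: "u \<rightarrow>\<^bsub>G\<^esub> v \<Longrightarrow> v \<rightarrow>\<^bsub>G\<^esub> u"
  by (rule graph_symmetric)

lemma dominates_commute: "u \<rightarrow>\<^bsub>G\<^esub> v \<longleftrightarrow> v \<rightarrow>\<^bsub>G\<^esub> u"
  using dominates_sym by blast

lemma not_dominates_self: "\<not> u \<rightarrow>\<^bsub>G\<^esub> u"
  using adj_not_same by blast

lemma components_cover:
  assumes "u \<in> verts G"
  obtains C where "C \<in> components G" "u \<in> verts C"
proof
  show "G \<restriction> {v. u \<rightarrow>\<^sup>* v} \<in> components G"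
    using assms by (rule induce_reachable_is_in_sccs)
  show "u \<in> verts (G \<restriction> {v. u \<rightarrow>\<^sup>* v})"
    using assms by simp
qed

lemma component_closed:
  assumes "C \<in> components G" "u \<in> verts C" "u \<rightarrow>\<^bsub>G\<^esub> v"
  shows "v \<in> verts C"
proof -
  have "verts C \<in> sccs_verts"
    using assms(1) by (simp add: sccs_verts_conv)
  moreover have "u \<rightarrow>\<^sup>* v" "v \<rightarrow>\<^sup>* u"
    using assms(3) by (auto intro: dominates_sym)
  ultimately show ?thesis
    using assms(2) unfolding in_sccs_verts_conv_reachable by blast
qed

lemma component_eqI:
  assumes "C \<in> components G" "D \<in> components G" "u \<in> verts C" "u \<in> verts D"
  shows "C = D"
  using assms scc_disj by blast

lemma component_subset: "C \<in> components G \<Longrightarrow> verts C \<subseteq> verts G"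
  by (auto dest!: in_sccs_imp_induced induced_imp_subgraph subgraph_imp_subverts)

lemma component_nonempty: "C \<in> components G \<Longrightarrow> verts C \<noteq> {}"
  by (auto simp: sccs_def strongly_connected_def)

lemma component_induce: "C \<in> components G \<Longrightarrow> G \<restriction> verts C = C"
  by (rule induce_eq_iff_induced[OF in_sccs_imp_induced])

lemma component_dominates_iff:
  "C \<in> components G \<Longrightarrow> u \<rightarrow>\<^bsub>C\<^esub> v \<longleftrightarrow> u \<in> verts C \<and> v \<in> verts C \<and> u \<rightarrow>\<^bsub>G\<^esub> v"
  by (rule dominates_induced_iff[OF in_sccs_imp_induced])

lemma component_of_edge_nontrivial:
  assumes "C \<in> components G" "u \<in> verts C" "u \<rightarrow>\<^bsub>G\<^esub> v"
  shows "nontrivial_component C G"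
proof -
  have "{u, v} \<subseteq> verts C"
    using assms component_closed by blast
  moreover have "finite (verts C)"
    using component_subset[OF assms(1)] finite_verts by (rule finite_subset)
  ultimately have "card {u, v} \<le> card (verts C)"
    by (rule card_mono[rotated])
  moreover have "u \<noteq> v"
    using assms(3) not_dominates_self by blast
  ultimately show ?thesis
    using assms(1) by (simp add: nontrivial_component_def)
qed

lemma edge_in_nontrivial_component:
  assumes "u \<rightarrow>\<^bsub>G\<^esub> v"
  obtains C where "nontrivial_component C G" "u \<in> verts C" "v \<in> verts C" "u \<rightarrow>\<^bsub>C\<^esub> v"
proof -
  obtain C where C: "C \<in> components G" "u \<in> verts C"
    using assms adj_in_verts(1) components_cover by metis
  then have "v \<in> verts C"
    using assms component_closed by blast
  with C assms show thesis
    using that component_of_edge_nontrivial component_dominates_iff by blast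
qed

lemma component_trivial_or_nontrivial:
  assumes "C \<in> components G"
  shows "trivial_component C G \<or> nontrivial_component C G"
proof -
  have "finite (verts C)"
    using component_subset[OF assms] finite_verts by (rule finite_subset)
  then have "card (verts C) \<noteq> 0"
    using component_nonempty[OF assms] by simp
  then show ?thesis
    using assms by (auto simp: trivial_component_def nontrivial_component_def)
qed

end

section \<open>Induced copies of small graphs\<close>

text \<open>
  The arcs of \<open>H\<close> and of \<open>G\<close> have unrelated types, so an isomorphism onto an induced subgraph also has
  to name an image for every arc. Without parallel arcs the ends determine that image, and an injective
  map on vertices that preserves and reflects adjacency is all that matters.
\<close>

lemma contains_induced_iff:
  assumes "nomulti_digraph G" and "nomulti_digraph H"
  shows "contains_induced G H \<longleftrightarrow>
    (\<exists>f. inj_on f (verts H) \<and> f ` verts H \<subseteq> verts G \<and>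
      (\<forall>u\<in>verts H. \<forall>v\<in>verts H. u \<rightarrow>\<^bsub>H\<^esub> v \<longleftrightarrow> f u \<rightarrow>\<^bsub>G\<^esub> f v))"
    (is "_ \<longleftrightarrow> (\<exists>f. ?emb f)")
proof
  interpret H: nomulti_digraph H by fact
  assume "contains_induced G H"
  then obtain K h where K: "induced_subgraph K G"
    and h: "H.digraph_isomorphism h" and KH: "K = app_iso h H"
    by (auto simp: contains_induced_def digraph_iso_def)
  have inj: "inj_on (iso_verts h) (verts H)"
    using h by (rule H.digraph_isomorphism_inj_on_verts)
  have adj: "u \<rightarrow>\<^bsub>H\<^esub> v \<longleftrightarrow> iso_verts h u \<rightarrow>\<^bsub>K\<^esub> iso_verts h v"
    if "u \<in> verts H" "v \<in> verts H" for u v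
  proof
    assume "iso_verts h u \<rightarrow>\<^bsub>K\<^esub> iso_verts h v"
    then obtain u' v' where "u' \<rightarrow>\<^bsub>H\<^esub> v'" "iso_verts h u = iso_verts h u'"
      "iso_verts h v = iso_verts h v'"
      unfolding KH H.arcs_ends_app_iso_eq[OF h] by auto
    then show "u \<rightarrow>\<^bsub>H\<^esub> v"
      using that inj H.adj_in_verts by (metis inj_onD)
  qed (force simp: KH H.arcs_ends_app_iso_eq[OF h])
  have "?emb (iso_verts h)"
    using inj adj dominates_induced_iff[OF K] subgraph_imp_subverts[OF induced_imp_subgraph[OF K]]
    unfolding KH by auto
  then show "\<exists>f. ?emb f"
    by (rule exI[of ?emb "iso_verts h"])
next
  interpret G: nomulti_digraph G by fact
  interpret H: nomulti_digraph H by fact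
  assume "\<exists>f. ?emb f"
  then obtain f where inj: "inj_on f (verts H)" and ran: "f ` verts H \<subseteq> verts G"
    and adj: "\<And>u v. u \<in> verts H \<Longrightarrow> v \<in> verts H \<Longrightarrow> u \<rightarrow>\<^bsub>H\<^esub> v \<longleftrightarrow> f u \<rightarrow>\<^bsub>G\<^esub> f v"
    by blast
  define arc_image where
    "arc_image e = (SOME e'. e' \<in> arcs G \<and> tail G e' = f (tail H e) \<and> head G e' = f (head H e))" for e
  have image: "arc_image e \<in> arcs G \<and> tail G (arc_image e) = f (tail H e) \<and>
      head G (arc_image e) = f (head H e)" if "e \<in> arcs H" for e
  proof -
    have "tail H e \<rightarrow>\<^bsub>H\<^esub> head H e"
      using that by (auto simp: arcs_ends_conv)
    then have "f (tail H e) \<rightarrow>\<^bsub>G\<^esub> f (head H e)"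
      using that adj by simp
    then show ?thesis
      unfolding arc_image_def by (elim reachableE) (rule someI_ex, blast)
  qed
  define h where "h = \<lparr>iso_verts = f, iso_arcs = arc_image, iso_head = head G, iso_tail = tail G\<rparr>"
  have "inj_on arc_image (arcs H)"
  proof (rule inj_onI)
    fix e e' assume e: "e \<in> arcs H" "e' \<in> arcs H" "arc_image e = arc_image e'"
    then have "f (tail H e) = f (tail H e')" "f (head H e) = f (head H e')"
      using image by metis+
    then have "arc_to_ends H e = arc_to_ends H e'"
      using e inj by (auto simp: arc_to_ends_def dest: inj_onD)
    then show "e = e'"
      using e H.no_multi_arcs by blast
  qed
  then have iso: "H.digraph_isomorphism h"
    using inj image by (simp add: H.digraph_isomorphism_def h_def H.wf_digraph)
  let ?K = "app_iso h H"
  have sub: "subgraph ?K G"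
    using ran image H.wf_digraphI_app_iso[OF iso] G.wf_digraph
    by (auto simp: subgraph_def compatible_def h_def)
  have "arcs ?K = {e \<in> arcs G. tail G e \<in> verts ?K \<and> head G e \<in> verts ?K}"
  proof (intro equalityI subsetI)
    fix e assume "e \<in> {e \<in> arcs G. tail G e \<in> verts ?K \<and> head G e \<in> verts ?K}"
    then obtain u v where e: "e \<in> arcs G" and uv: "u \<in> verts H" "v \<in> verts H"
      and ends: "tail G e = f u" "head G e = f v"
      by (auto simp: h_def)
    then have "f u \<rightarrow>\<^bsub>G\<^esub> f v"
      by (auto simp: arcs_ends_conv rev_image_eqI)
    then obtain e' where e': "e' \<in> arcs H" "tail H e' = u" "head H e' = v"
      using adj[OF uv] by blast
    then have "arc_image e' = e"
      using e ends image[OF e'(1)] by (intro G.no_multi_arcs) (auto simp: arc_to_ends_def)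
    then show "e \<in> arcs ?K"
      using e' by (auto simp: h_def)
  qed (use image in \<open>auto simp: h_def\<close>)
  then have "induced_subgraph ?K G"
    using sub by (simp add: induced_subgraph_def)
  then show "contains_induced G H"
    using iso by (auto simp: contains_induced_def digraph_iso_def)
qed

lemma nomulti_sym_graph:
  assumes "E \<subseteq> V \<times> V"
  shows "nomulti_digraph (sym_graph V E)"
  using assms by unfold_locales (auto simp: sym_graph_def arc_to_ends_def)

lemma nomulti_H:
  "nomulti_digraph H1" "nomulti_digraph H2" "nomulti_digraph H3"
  unfolding H1_def H2_def H3_def by (rule nomulti_sym_graph, simp)+

definition induces_2K2 :: "('a, 'b) pre_digraph \<Rightarrow> 'a \<Rightarrow> 'a \<Rightarrow> 'a \<Rightarrow> 'a \<Rightarrow> bool" where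
  "induces_2K2 G a b c d \<longleftrightarrow> distinct [a, b, c, d] \<and> a \<rightarrow>\<^bsub>G\<^esub> b \<and> c \<rightarrow>\<^bsub>G\<^esub> d \<and>
     \<not> a \<rightarrow>\<^bsub>G\<^esub> c \<and> \<not> a \<rightarrow>\<^bsub>G\<^esub> d \<and> \<not> b \<rightarrow>\<^bsub>G\<^esub> c \<and> \<not> b \<rightarrow>\<^bsub>G\<^esub> d"

lemma two_K2_free_iff: "two_K2_free G \<longleftrightarrow> (\<nexists>a b c d. induces_2K2 G a b c d)"
  by (simp add: two_K2_free_def induces_2K2_def)

lemma induces_2K2_induce_iff:
  "induces_2K2 (G \<restriction> X) a b c d \<longleftrightarrow> {a, b, c, d} \<subseteq> X \<and> induces_2K2 G a b c d"
  by (auto simp: induces_2K2_def dominates_induce_iff)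

lemma two_K2_free_induce: "two_K2_free G \<Longrightarrow> two_K2_free (G \<restriction> X)"
  by (auto simp: two_K2_free_iff induces_2K2_induce_iff)

lemma two_K2_free_contains_induced:
  assumes "nomulti_digraph G" "nomulti_digraph H" "contains_induced G H" "two_K2_free G"
  shows "two_K2_free H"
proof (rule ccontr)
  interpret H: nomulti_digraph H by fact
  assume "\<not> two_K2_free H"
  then obtain a b c d where 2: "induces_2K2 H a b c d"
    by (auto simp: two_K2_free_iff)
  then have V: "a \<in> verts H" "b \<in> verts H" "c \<in> verts H" "d \<in> verts H"
    using H.adj_in_verts by (auto simp: induces_2K2_def)
  obtain f where "inj_on f (verts H)"
    "\<forall>u\<in>verts H. \<forall>v\<in>verts H. u \<rightarrow>\<^bsub>H\<^esub> v \<longleftrightarrow> f u \<rightarrow>\<^bsub>G\<^esub> f v"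
    using assms(3) contains_induced_iff[OF assms(1,2)] by blast
  then have "induces_2K2 G (f a) (f b) (f c) (f d)"
    using 2 V by (simp add: induces_2K2_def inj_on_eq_iff)
  then show False
    using assms(4) by (auto simp: two_K2_free_iff)
qed

lemma H_not_two_K2_free: "\<not> two_K2_free H1" "\<not> two_K2_free H2" "\<not> two_K2_free H3"
proof -
  have "induces_2K2 H1 1 2 4 5" "induces_2K2 H2 1 2 4 5" "induces_2K2 H3 1 2 4 5"
    by (simp_all add: induces_2K2_def H1_def H2_def H3_def sym_graph_def)
  then show "\<not> two_K2_free H1" "\<not> two_K2_free H2" "\<not> two_K2_free H3"
    unfolding two_K2_free_iff by blast+
qed

lemma two_K2_free_imp_H_free:
  assumes "nomulti_digraph G" "two_K2_free G"
  shows "H_free G"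
  using assms two_K2_free_contains_induced nomulti_H H_not_two_K2_free
  unfolding H_free_def by metis

context graph
begin

text \<open>
  The vertices \<open>1, \<dots>, 5\<close> are sent to the entries of the list in order, so the third entry is the image
  of the middle vertex \<open>3\<close>.
\<close>

lemma contains_induced_on_five:
  assumes "distinct [a, b, x, c, d]" "{a, b, x, c, d} \<subseteq> verts G"
    and "nomulti_digraph H" "verts H = {1, 2, 3, 4, 5 :: nat}"
    and "\<forall>i\<in>{1, 2, 3, 4, 5}. \<forall>j\<in>{1, 2, 3, 4, 5}.
      i \<rightarrow>\<^bsub>H\<^esub> j \<longleftrightarrow> [a, b, x, c, d] ! (i - 1) \<rightarrow>\<^bsub>G\<^esub> [a, b, x, c, d] ! (j - 1)"
  shows "contains_induced G H"
  unfolding contains_induced_iff[OF nomulti_digraph assms(3)]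
proof (intro exI conjI)
  let ?f = "\<lambda>i. [a, b, x, c, d] ! (i - 1)"
  show "inj_on ?f (verts H)"
    using assms(1) unfolding assms(4) by (auto simp: inj_on_def)
  show "?f ` verts H \<subseteq> verts G"
    using assms(2) unfolding assms(4) by simp
  show "\<forall>i\<in>verts H. \<forall>j\<in>verts H. i \<rightarrow>\<^bsub>H\<^esub> j \<longleftrightarrow> ?f i \<rightarrow>\<^bsub>G\<^esub> ?f j"
    using assms(5) unfolding assms(4) by blast
qed

text \<open>
  The five vertices induce \<open>H3\<close> if \<open>x\<close> is adjacent to both ends of both edges, \<open>H2\<close> if to both ends
  of exactly one, and \<open>H1\<close> if to one end of each. Only the order in which the vertices are listed varies
  between the cases.
\<close>

lemma not_H_free_if_2K2_with_common_neighbour: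
  assumes 2: "induces_2K2 G a b c d" and "a \<rightarrow>\<^bsub>G\<^esub> x" "x \<notin> {b, c, d}" "x \<rightarrow>\<^bsub>G\<^esub> c \<or> x \<rightarrow>\<^bsub>G\<^esub> d"
  shows "\<not> H_free G"
proof -
  note adj = 2[unfolded induces_2K2_def]
  have V: "{a, b, x, c, d} \<subseteq> verts G"
    using adj assms(2) adj_in_verts by auto
  have nx: "x \<noteq> a"
    using assms(2) not_dominates_self by blast
  have D: "distinct [b, a, x, c, d]" "distinct [a, b, x, c, d]" "distinct [b, a, x, d, c]"
    "distinct [a, b, x, d, c]" "distinct [c, d, x, a, b]"
    using adj assms(3) nx by auto
  have V': "{b, a, x, c, d} \<subseteq> verts G" "{b, a, x, d, c} \<subseteq> verts G"
    "{a, b, x, d, c} \<subseteq> verts G" "{c, d, x, a, b} \<subseteq> verts G"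
    using V by auto
  have neg: "\<not> a \<rightarrow>\<^bsub>G\<^esub> c" "\<not> a \<rightarrow>\<^bsub>G\<^esub> d" "\<not> b \<rightarrow>\<^bsub>G\<^esub> c" "\<not> b \<rightarrow>\<^bsub>G\<^esub> d" "\<not> c \<rightarrow>\<^bsub>G\<^esub> a" "\<not> d \<rightarrow>\<^bsub>G\<^esub> a" "\<not> c \<rightarrow>\<^bsub>G\<^esub> b" "\<not> d \<rightarrow>\<^bsub>G\<^esub> b"
    and pos: "a \<rightarrow>\<^bsub>G\<^esub> b" "b \<rightarrow>\<^bsub>G\<^esub> a" "c \<rightarrow>\<^bsub>G\<^esub> d" "d \<rightarrow>\<^bsub>G\<^esub> c" "a \<rightarrow>\<^bsub>G\<^esub> x" "x \<rightarrow>\<^bsub>G\<^esub> a"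
    using adj assms(2) dominates_commute by blast+
  have sym: "b \<rightarrow>\<^bsub>G\<^esub> x \<longleftrightarrow> x \<rightarrow>\<^bsub>G\<^esub> b" "c \<rightarrow>\<^bsub>G\<^esub> x \<longleftrightarrow> x \<rightarrow>\<^bsub>G\<^esub> c" "d \<rightarrow>\<^bsub>G\<^esub> x \<longleftrightarrow> x \<rightarrow>\<^bsub>G\<^esub> d"
    using dominates_commute by blast+
  note facts = neg pos sym not_dominates_self H1_def H2_def H3_def sym_graph_def
  consider "x \<rightarrow>\<^bsub>G\<^esub> b" "x \<rightarrow>\<^bsub>G\<^esub> c" "x \<rightarrow>\<^bsub>G\<^esub> d" | "x \<rightarrow>\<^bsub>G\<^esub> b" "x \<rightarrow>\<^bsub>G\<^esub> c" "\<not> x \<rightarrow>\<^bsub>G\<^esub> d" | "x \<rightarrow>\<^bsub>G\<^esub> b" "\<not> x \<rightarrow>\<^bsub>G\<^esub> c" "x \<rightarrow>\<^bsub>G\<^esub> d"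
    | "\<not> x \<rightarrow>\<^bsub>G\<^esub> b" "x \<rightarrow>\<^bsub>G\<^esub> c" "x \<rightarrow>\<^bsub>G\<^esub> d" | "\<not> x \<rightarrow>\<^bsub>G\<^esub> b" "x \<rightarrow>\<^bsub>G\<^esub> c" "\<not> x \<rightarrow>\<^bsub>G\<^esub> d" | "\<not> x \<rightarrow>\<^bsub>G\<^esub> b" "\<not> x \<rightarrow>\<^bsub>G\<^esub> c" "x \<rightarrow>\<^bsub>G\<^esub> d"
    using assms(4) by blast
  then have "contains_induced G H1 \<or> contains_induced G H2 \<or> contains_induced G H3"
  proof cases
    case 1
    have "contains_induced G H3"
      by (rule contains_induced_on_five[OF D(2) V nomulti_H(3)]) (use 1 in \<open>simp_all add: facts\<close>)
    then show ?thesis by blast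
  next
    case 2
    have "contains_induced G H2"
      by (rule contains_induced_on_five[OF D(2) V nomulti_H(2)]) (use 2 in \<open>simp_all add: facts\<close>)
    then show ?thesis by blast
  next
    case 3
    have "contains_induced G H2"
      by (rule contains_induced_on_five[OF D(4) V'(3) nomulti_H(2)]) (use 3 in \<open>simp_all add: facts\<close>)
    then show ?thesis by blast
  next
    case 4
    have "contains_induced G H2"
      by (rule contains_induced_on_five[OF D(5) V'(4) nomulti_H(2)]) (use 4 in \<open>simp_all add: facts\<close>)
    then show ?thesis by blast
  next
    case 5
    have "contains_induced G H1"
      by (rule contains_induced_on_five[OF D(1) V'(1) nomulti_H(1)]) (use 5 in \<open>simp_all add: facts\<close>)
    then show ?thesis by blast
  next
    case 6
    have "contains_induced G H1"
      by (rule contains_induced_on_five[OF D(3) V'(2) nomulti_H(1)]) (use 6 in \<open>simp_all add: facts\<close>)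
    then show ?thesis by blast
  qed
  then show ?thesis
    by (auto simp: H_free_def)
qed

text \<open>
  The induction runs along a walk from \<open>a\<close> to \<open>c\<close>, with the other end \<open>b\<close> of the first edge left
  arbitrary. If the next vertex \<open>p\<close> sees neither \<open>c\<close> nor \<open>d\<close>, then \<open>pa\<close> and \<open>cd\<close> again form a $2K_2$,
  which starts closer to \<open>c\<close>; otherwise \<open>p\<close> is a common neighbour of the two edges.
\<close>

lemma not_H_free_if_reachable_2K2:
  assumes "a \<rightarrow>\<^sup>* c" "induces_2K2 G a b c d"
  shows "\<not> H_free G"
  using assms
proof (induction arbitrary: b rule: converse_reachable_induct)
  case base
  then show ?case by (simp add: induces_2K2_def)
next
  case (step a p)
  show ?case
  proof (cases "p = b \<or> p \<rightarrow>\<^bsub>G\<^esub> c \<or> p \<rightarrow>\<^bsub>G\<^esub> d")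
    case True
    show ?thesis
    proof (cases "p = b")
      case True
      then have "induces_2K2 G p a c d"
        using step.prems dominates_sym by (auto simp: induces_2K2_def)
      then show ?thesis by (rule step.IH)
    next
      case False
      then have "p \<rightarrow>\<^bsub>G\<^esub> c \<or> p \<rightarrow>\<^bsub>G\<^esub> d"
        using True by blast
      moreover have "p \<notin> {b, c, d}"
        using False step.hyps step.prems by (auto simp: induces_2K2_def)
      ultimately show ?thesis
        using not_H_free_if_2K2_with_common_neighbour[OF step.prems step.hyps(1)] by blast
    qed
  next
    case False
    moreover have "p \<noteq> a" "p \<notin> {c, d}"
      using step.hyps step.prems not_dominates_self by (auto simp: induces_2K2_def)
    ultimately have "induces_2K2 G p a c d"
      using step.hyps step.prems dominates_sym by (auto simp: induces_2K2_def)
    then show ?thesis by (rule step.IH)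
  qed
qed

lemma strongly_connected_H_free_imp_two_K2_free:
  assumes "strongly_connected G" "H_free G"
  shows "two_K2_free G"
proof -
  have "\<not> induces_2K2 G a b c d" for a b c d
  proof
    assume 2: "induces_2K2 G a b c d"
    then have "a \<in> verts G" "c \<in> verts G"
      using adj_in_verts by (auto simp: induces_2K2_def)
    then have "a \<rightarrow>\<^sup>* c"
      using assms(1) by blast
    then show False
      using 2 assms(2) not_H_free_if_reachable_2K2 by blast
  qed
  then show ?thesis
    by (simp add: two_K2_free_iff)
qed

lemma two_K2_free_imp_at_most_one_nontrivial_component:
  assumes "two_K2_free G"
  shows "at_most_one_nontrivial_component G"
  unfolding at_most_one_nontrivial_component_def
proof (intro allI impI, rule ccontr)
  have edge: "\<exists>u v. u \<in> verts C \<and> v \<in> verts C \<and> u \<rightarrow>\<^bsub>G\<^esub> v" if "nontrivial_component C G" for C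
  proof -
    have C: "C \<in> components G" "card (verts C) \<ge> 2"
      using that by (auto simp: nontrivial_component_def)
    obtain u v where uv: "u \<in> verts C" "v \<in> verts C" "u \<noteq> v"
      using C(2) by (auto simp: numeral_2_eq_2 card_le_Suc_iff)
    have "strongly_connected C"
      using C(1) by (auto simp: sccs_def)
    then have "u \<rightarrow>\<^sup>*\<^bsub>C\<^esub> v"
      using uv by blast
    then obtain w where "u \<rightarrow>\<^bsub>C\<^esub> w"
      using uv(3) by (auto elim: pre_digraph.converse_reachable_cases)
    then show ?thesis
      using component_dominates_iff[OF C(1)] by blast
  qed
  fix C D assume CD: "nontrivial_component C G \<and> nontrivial_component D G" and "C \<noteq> D"
  then have comps: "C \<in> components G" "D \<in> components G"
    by (auto simp: nontrivial_component_def)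
  obtain a b where ab: "a \<in> verts C" "b \<in> verts C" "a \<rightarrow>\<^bsub>G\<^esub> b"
    using CD edge by blast
  obtain c d where cd: "c \<in> verts D" "d \<in> verts D" "c \<rightarrow>\<^bsub>G\<^esub> d"
    using CD edge by blast
  have out: "c \<notin> verts C" "d \<notin> verts C"
    using cd comps \<open>C \<noteq> D\<close> component_eqI by blast+
  then have "\<not> x \<rightarrow>\<^bsub>G\<^esub> y" if "x \<in> verts C" "y \<in> {c, d}" for x y
    using that component_closed[OF comps(1)] by blast
  then have "induces_2K2 G a b c d"
    using ab cd out not_dominates_self by (auto simp: induces_2K2_def)
  then show False
    using assms by (auto simp: two_K2_free_iff)
qed

lemma connected_imp_at_most_one_nontrivial_component:
  assumes "connected G"
  shows "at_most_one_nontrivial_component G"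
proof -
  have "strongly_connected G"
    using sym_arcs assms by (rule symmetric_connected_imp_strongly_connected)
  then have "components G = {G}"
    by (simp add: strongly_connected_eq_iff)
  then show ?thesis
    by (simp add: at_most_one_nontrivial_component_def nontrivial_component_def)
qed

lemma two_K2_free_if_nontrivial_components_free:
  assumes "at_most_one_nontrivial_component G"
    and "\<And>C. nontrivial_component C G \<Longrightarrow> two_K2_free C"
  shows "two_K2_free G"
proof -
  have "\<not> induces_2K2 G a b c d" for a b c d
  proof
    assume 2: "induces_2K2 G a b c d"
    obtain C where C: "nontrivial_component C G" "a \<in> verts C" "b \<in> verts C"
      using 2 edge_in_nontrivial_component by (metis induces_2K2_def)
    obtain D where D: "nontrivial_component D G" "c \<in> verts D" "d \<in> verts D"
      using 2 edge_in_nontrivial_component by (metis induces_2K2_def)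
    have "C = D"
      using assms(1) C D by (auto simp: at_most_one_nontrivial_component_def)
    moreover have "G \<restriction> verts C = C"
      using C by (auto simp: nontrivial_component_def component_induce)
    ultimately have "induces_2K2 C a b c d"
      using 2 C D induces_2K2_induce_iff[of G "verts C" a b c d] by simp
    then show False
      using assms(2) C by (auto simp: two_K2_free_iff)
  qed
  then show ?thesis
    by (simp add: two_K2_free_iff)
qed

end

section \<open>Minimal vertex separators\<close>

locale minimally_separated_graph = graph G for G :: "('a, 'b) pre_digraph" (structure) +
  fixes S :: "'a set"
  assumes minimal_separator: "minimal_vertex_separator G S"
begin

abbreviation rest :: "('a, 'b) pre_digraph" where
  "rest \<equiv> delete_verts G S"

lemma separator_subset: "S \<subseteq> verts G"
  using minimal_separator by (simp add: minimal_vertex_separator_def vertex_separator_def)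

lemma graph_delete: "graph (delete_verts G R)"
  unfolding delete_verts_def by (rule graph_induce) (unfold_locales, auto)

sublocale rest: graph rest
  by (rule graph_delete)

sublocale sep: graph "G \<restriction> S"
  by (rule graph_induce[OF _ separator_subset]) unfold_locales

lemma rest_dominates_iff:
  "u \<rightarrow>\<^bsub>rest\<^esub> v \<longleftrightarrow> u \<notin> S \<and> v \<notin> S \<and> u \<rightarrow>\<^bsub>G\<^esub> v"
  using adj_in_verts by (auto simp: delete_verts_def dominates_induce_iff)

lemma verts_rest: "verts rest = verts G - S"
  by (simp add: delete_verts_def)

lemma other_component:
  assumes "C \<in> components rest"
  obtains D where "D \<in> components rest" "D \<noteq> C"
proof -
  have "2 \<le> card (components rest)"
    using minimal_separator by (simp add: minimal_vertex_separator_def vertex_separator_def)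
  then have "\<not> components rest \<subseteq> {C}"
    using card_mono[of "{C}" "components rest"] by auto
  then show thesis
    using that by blast
qed

text \<open>
  If \<open>s\<close> had no neighbour in \<open>C\<close>, then \<open>C\<close> would remain cut off from the other components after putting
  \<open>s\<close> back, so that \<open>S - {s}\<close> would already separate \<open>G\<close>.
\<close>

lemma component_has_neighbour:
  assumes "s \<in> S" "C \<in> components rest"
  obtains w where "w \<in> verts C" "s \<rightarrow>\<^bsub>G\<^esub> w"
proof (rule ccontr)
  assume "\<not> thesis"
  with that have isolated: "\<And>w. w \<in> verts C \<Longrightarrow> \<not> s \<rightarrow>\<^bsub>G\<^esub> w"
    by blast
  let ?K = "delete_verts G (S - {s})"
  interpret K: graph ?K
    by (rule graph_delete)
  obtain D where D: "D \<in> components rest" "D \<noteq> C"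
    using assms(2) other_component by blast
  obtain c d where cd: "c \<in> verts C" "d \<in> verts D"
    using assms(2) D rest.component_nonempty by blast
  then have cdK: "c \<in> verts ?K" "d \<in> verts ?K"
    using rest.component_subset assms(2) D(1) by (auto simp: delete_verts_def)
  \<comment> \<open>By minimality all vertices outside \<open>S - {s}\<close> lie in a single component.\<close>
  have "S - {s} \<subset> S" "S - {s} \<subseteq> verts G"
    using assms(1) separator_subset by auto
  then have "card (components ?K) < 2"
    using minimal_separator by (auto simp: minimal_vertex_separator_def vertex_separator_def)
  then have "card K.sccs_verts < 2"
    by (simp add: K.card_sccs_verts)
  then have "K.scc_of c = K.scc_of d"
    using K.scc_of_in_sccs_verts cdK K.finite_sccs_verts
    by (metis card_le_Suc0_iff_eq less_Suc_eq_le numeral_2_eq_2)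
  then have "c \<rightarrow>\<^sup>*\<^bsub>?K\<^esub> d"
    using cdK K.in_scc_of_self by (auto simp: K.scc_of_def)
  then have "d \<in> verts C"
  proof (induction rule: K.reachable_induct)
    case base
    show ?case by (rule cd)
  next
    case (step x y)
    have xy: "x \<rightarrow>\<^bsub>G\<^esub> y" "y \<notin> S - {s}"
      using step.hyps(2) by (auto simp: delete_verts_def dominates_induce_iff)
    moreover have "y \<noteq> s"
      using isolated[OF step.IH] xy dominates_sym by blast
    moreover have "x \<notin> S"
      using step.IH rest.component_subset[OF assms(2)] by (auto simp: verts_rest)
    ultimately have "x \<rightarrow>\<^bsub>rest\<^esub> y"
      by (auto simp: rest_dominates_iff)
    then show ?case
      using rest.component_closed assms(2) step.IH by blast
  qed
  then show False
    using rest.component_eqI assms(2) D cd by blast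
qed

lemma trivial_component_universal:
  assumes "trivial_component C rest" "t \<in> verts C"
  shows "vertex_universal G t S"
proof -
  have C: "C \<in> components rest" "verts C = {t}"
    using assms by (auto simp: trivial_component_def card_1_singleton_iff)
  then have "t \<notin> S"
    using rest.component_subset by (auto simp: verts_rest)
  moreover have "t \<rightarrow>\<^bsub>G\<^esub> s" if "s \<in> S" for s
  proof -
    obtain w where "w \<in> verts C" "s \<rightarrow>\<^bsub>G\<^esub> w"
      using \<open>s \<in> S\<close> C(1) by (rule component_has_neighbour)
    then show ?thesis
      using C(2) dominates_sym by simp
  qed
  ultimately show ?thesis
    by (simp add: vertex_universal_def)
qed

text \<open>
  Every vertex of the separator is adjacent to the component, and so reaches any chosen root \<open>r\<close> in it.
\<close>

lemma strongly_connected_with_separator: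
  assumes "C \<in> components rest"
  shows "strongly_connected (G \<restriction> (verts C \<union> S))"
proof -
  let ?K = "G \<restriction> (verts C \<union> S)"
  have sub: "verts C \<subseteq> verts G"
    using rest.component_subset[OF assms] by (auto simp: verts_rest)
  interpret K: graph ?K
    by (rule graph_induce) (unfold_locales, use sub separator_subset in auto)
  obtain r where r: "r \<in> verts C"
    using rest.component_nonempty[OF assms] by blast
  have from_C: "v \<rightarrow>\<^sup>*\<^bsub>?K\<^esub> r" if "v \<in> verts C" for v
  proof -
    have "v \<rightarrow>\<^sup>*\<^bsub>C\<^esub> r"
      using that r assms by (auto simp: pre_digraph.sccs_def)
    moreover have "rest \<restriction> verts C = C"
      using assms by (rule rest.component_induce)
    moreover have "(rest \<restriction> verts C) = G \<restriction> verts C"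
      using rest.component_subset[OF assms] by (auto simp: delete_verts_def induce_subgraph_def)
    ultimately have "v \<rightarrow>\<^sup>*\<^bsub>G \<restriction> verts C\<^esub> r"
      by simp
    then show ?thesis
      by (rule reachable_induce_ss) simp
  qed
  have to_r: "v \<rightarrow>\<^sup>*\<^bsub>?K\<^esub> r" if "v \<in> verts ?K" for v
  proof (cases "v \<in> verts C")
    case False
    then have "v \<in> S"
      using that by simp
    then obtain w where w: "w \<in> verts C" "v \<rightarrow>\<^bsub>G\<^esub> w"
      using assms component_has_neighbour by blast
    then have "v \<rightarrow>\<^bsub>?K\<^esub> w"
      using \<open>v \<in> S\<close> by (simp add: dominates_induce_iff)
    then show ?thesis
      using from_C[OF w(1)] by (rule K.adj_reachable_trans)
  qed (rule from_C)
  show ?thesis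
  proof (rule strongly_connectedI)
    show "verts ?K \<noteq> {}"
      using r by auto
    show "u \<rightarrow>\<^sup>*\<^bsub>?K\<^esub> v" if "u \<in> verts ?K" "v \<in> verts ?K" for u v
      using to_r[OF that(1)] K.symmetric_reachable'[OF to_r[OF that(2)]]
      by (rule K.reachable_trans)
  qed
qed

text \<open>
  A vertex of \<open>S\<close> that the edge misses has a neighbour in another component, and the edge to that
  neighbour forms a $2K_2$ with the given one.
\<close>

lemma component_edge_universal:
  assumes "two_K2_free G" "C \<in> components rest" "u \<rightarrow>\<^bsub>C\<^esub> v"
  shows "edge_universal G u v S"
  unfolding edge_universal_def
proof (rule ballI, rule ccontr)
  fix s assume s: "s \<in> S" and no: "\<not> (s \<rightarrow>\<^bsub>G\<^esub> u \<or> s \<rightarrow>\<^bsub>G\<^esub> v)"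
  obtain D where D: "D \<in> components rest" "D \<noteq> C"
    using assms(2) other_component by blast
  obtain w where w: "w \<in> verts D" "s \<rightarrow>\<^bsub>G\<^esub> w"
    using component_has_neighbour[OF s D(1)] by blast
  have uv: "u \<in> verts C" "v \<in> verts C" "u \<rightarrow>\<^bsub>G\<^esub> v"
    using assms(3) rest.component_dominates_iff[OF assms(2)] by (auto simp: rest_dominates_iff)
  have outside: "u \<notin> S" "v \<notin> S" "w \<notin> S"
    using uv w rest.component_subset[OF assms(2)] rest.component_subset[OF D(1)]
    by (auto simp: verts_rest)
  have "w \<notin> verts C"
    using rest.component_eqI[OF assms(2) D(1) _ w(1)] D(2) by blast
  then have "\<not> u \<rightarrow>\<^bsub>G\<^esub> w" "\<not> v \<rightarrow>\<^bsub>G\<^esub> w" "u \<noteq> w" "v \<noteq> w"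
    using uv outside rest.component_closed[OF assms(2)] rest_dominates_iff by blast+
  moreover have "\<not> u \<rightarrow>\<^bsub>G\<^esub> s" "\<not> v \<rightarrow>\<^bsub>G\<^esub> s" "u \<noteq> s" "v \<noteq> s" "s \<noteq> w" "u \<noteq> v"
    using no s outside dominates_sym uv(3) not_dominates_self by blast+
  ultimately have "induces_2K2 G u v s w"
    using uv(3) w(2) by (simp add: induces_2K2_def)
  then show False
    using assms(1) by (auto simp: two_K2_free_iff)
qed

text \<open>
  Choose \<open>y\<close> in \<open>S\<close> adjacent to neither \<open>u\<close> nor \<open>v\<close>. A vertex \<open>x\<close> of the set is adjacent to \<open>y\<close>, so if
  it saw neither \<open>u\<close> nor \<open>v\<close>, then \<open>uv\<close> and \<open>xy\<close> would form a $2K_2$.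
\<close>

lemma separator_edge_universal:
  assumes "two_K2_free G" "u \<in> S" "v \<in> S" "u \<rightarrow>\<^bsub>G\<^esub> v" "W \<inter> S = {}"
    and "S - (neighbours G u \<union> neighbours G v) \<noteq> {}"
  shows "edge_universal G u v (M_set G W S u v)"
  unfolding edge_universal_def
proof (rule ballI, rule ccontr)
  obtain y where y: "y \<in> S" "\<not> u \<rightarrow>\<^bsub>G\<^esub> y" "\<not> v \<rightarrow>\<^bsub>G\<^esub> y"
    using assms(6) by (auto simp: neighbours_def)
  fix x assume x: "x \<in> M_set G W S u v" and no: "\<not> (x \<rightarrow>\<^bsub>G\<^esub> u \<or> x \<rightarrow>\<^bsub>G\<^esub> v)"
  then have "x \<rightarrow>\<^bsub>G\<^esub> y" "x \<notin> S"
    using y assms(5) by (auto simp: M_set_def neighbours_def)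
  then have "induces_2K2 G u v x y"
    using assms(2-4) y no dominates_commute[of x] dominates_commute[of u v] not_dominates_self
    by (auto simp: induces_2K2_def)
  then show False
    using assms(1) by (auto simp: two_K2_free_iff)
qed

text \<open>
  No $2K_2$ can meet a trivial component, so its vertices all lie in \<open>S\<close> and the non-trivial component,
  where \<open>rest_free\<close> or, if there is no such component, \<open>sep_free\<close> excludes it.
\<close>

lemma two_K2_freeI:
  assumes one: "at_most_one_nontrivial_component rest"
    and rest_free: "\<And>C. nontrivial_component C rest \<Longrightarrow> two_K2_free (G \<restriction> (verts C \<union> S))"
    and edges: "\<And>C u v. nontrivial_component C rest \<Longrightarrow> u \<rightarrow>\<^bsub>C\<^esub> v \<Longrightarrow> edge_universal G u v S"
    and sep_free: "two_K2_free (G \<restriction> S)"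
  shows "two_K2_free G"
proof -
  have no_trivial: "a \<notin> verts C" if 2: "induces_2K2 G a b c d" and C: "trivial_component C rest"
    for a b c d C
  proof
    assume a: "a \<in> verts C"
    have t: "vertex_universal G a S"
      using C a by (rule trivial_component_universal)
    have "b \<in> S"
    proof (rule ccontr)
      assume "b \<notin> S"
      then have "a \<rightarrow>\<^bsub>rest\<^esub> b"
        using 2 t by (auto simp: induces_2K2_def rest_dominates_iff vertex_universal_def)
      then have "nontrivial_component C rest"
        using rest.component_of_edge_nontrivial C a by (auto simp: trivial_component_def)
      then show False
        using C by (simp add: trivial_component_def nontrivial_component_def)
    qed
    have "c \<rightarrow>\<^bsub>rest\<^esub> d"
      using 2 t by (auto simp: induces_2K2_def rest_dominates_iff vertex_universal_def)
    then obtain D where "nontrivial_component D rest" "c \<rightarrow>\<^bsub>D\<^esub> d"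
      using rest.edge_in_nontrivial_component by blast
    then have "b \<rightarrow>\<^bsub>G\<^esub> c \<or> b \<rightarrow>\<^bsub>G\<^esub> d"
      using edges \<open>b \<in> S\<close> by (auto simp: edge_universal_def)
    then show False
      using 2 by (auto simp: induces_2K2_def)
  qed
  have "\<not> induces_2K2 G a b c d" for a b c d
  proof
    assume 2: "induces_2K2 G a b c d"
    \<comment> \<open>A $2K_2$ may be read starting from any of its four vertices.\<close>
    then have perms: "induces_2K2 G b a c d" "induces_2K2 G c d a b" "induces_2K2 G d c a b"
      using dominates_commute by (auto simp: induces_2K2_def)
    have location: "x \<in> S \<or> (\<exists>C. nontrivial_component C rest \<and> x \<in> verts C)"
      if x: "x \<in> {a, b, c, d}" for x
    proof (cases "x \<in> S")
      case False
      have "x \<in> verts G"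
        using 2 x adj_in_verts by (auto simp: induces_2K2_def)
      then obtain C where C: "C \<in> components rest" "x \<in> verts C"
        using False rest.components_cover by (metis DiffI verts_rest)
      then have "\<not> trivial_component C rest"
        using no_trivial 2 perms x by blast
      then show ?thesis
        using C rest.component_trivial_or_nontrivial by blast
    qed simp
    show False
    proof (cases "\<exists>C. nontrivial_component C rest")
      case True
      then obtain C where C: "nontrivial_component C rest" by blast
      then have "{a, b, c, d} \<subseteq> verts C \<union> S"
        using location one by (auto simp: at_most_one_nontrivial_component_def)
      then have "induces_2K2 (G \<restriction> (verts C \<union> S)) a b c d"
        using 2 by (simp add: induces_2K2_induce_iff)
      then show False
        using rest_free[OF C] by (auto simp: two_K2_free_iff)
    next
      case False
      then have "induces_2K2 (G \<restriction> S) a b c d"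
        using 2 location by (auto simp: induces_2K2_induce_iff)
      then show False
        using sep_free by (auto simp: two_K2_free_iff)
    qed
  qed
  then show ?thesis
    by (simp add: two_K2_free_iff)
qed

end

section \<open>The characterisation\<close>

theorem theorem1:
  fixes G :: "('a, 'b) pre_digraph" and S :: "'a set"
  assumes "graph G"
    and "connected G"
    and "minimal_vertex_separator G S"
  shows "two_K2_free G \<longleftrightarrow>
    (at_most_one_nontrivial_component (delete_verts G S) \<and>
      (\<forall>G1. nontrivial_component G1 (delete_verts G S) \<longrightarrow> H_free (G \<restriction> (verts G1 \<union> S)))) \<and>
    (\<forall>C. trivial_component C (delete_verts G S) \<longrightarrow>
      (\<forall>t \<in> verts C. vertex_universal G t S)) \<and>
    (\<forall>G1. nontrivial_component G1 (delete_verts G S) \<longrightarrow>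
      (\<forall>u v. u \<rightarrow>\<^bsub>G1\<^esub> v \<longrightarrow> edge_universal G u v S)) \<and>
    ((connected (G \<restriction> S) \<or> at_most_one_nontrivial_component (G \<restriction> S)) \<and>
      (\<forall>S1. nontrivial_component S1 (G \<restriction> S) \<longrightarrow> H_free (G \<restriction> verts S1))) \<and>
    (\<forall>S1 G1. nontrivial_component S1 (G \<restriction> S) \<and> nontrivial_component G1 (delete_verts G S) \<longrightarrow>
      (\<forall>u v. u \<rightarrow>\<^bsub>S1\<^esub> v \<and> S - (neighbours G u \<union> neighbours G v) \<noteq> {} \<longrightarrow>
        edge_universal G u v (M_set G (verts G1) S u v)))"
    (is "_ \<longleftrightarrow> (?one \<and> ?rest_H) \<and> ?triv \<and> ?edge \<and> (?sep \<and> ?sep_H) \<and> ?M")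
proof -
  interpret minimally_separated_graph G S
    by (rule minimally_separated_graph.intro[OF assms(1) minimally_separated_graph_axioms.intro[OF assms(3)]])
  have induced_graph: "graph (G \<restriction> X)" if "X \<subseteq> verts G" for X
    using assms(1) that by (rule graph_induce)
  have G1_sub: "verts C \<subseteq> verts G - S" if "nontrivial_component C rest" for C
    using that rest.component_subset by (auto simp: nontrivial_component_def verts_rest)
  have S1_sub: "verts C \<subseteq> S" if "nontrivial_component C (G \<restriction> S)" for C
    using that sep.component_subset by (auto simp: nontrivial_component_def)
  have S1_eq: "G \<restriction> verts C = C" if "nontrivial_component C (G \<restriction> S)" for C
  proof -
    have "(G \<restriction> S) \<restriction> verts C = C"
      using that sep.component_induce by (simp add: nontrivial_component_def)
    then show ?thesis
      using S1_sub[OF that] by (simp add: induce_induce)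
  qed
  show ?thesis
  proof
    assume free: "two_K2_free G"
    have H: "H_free (G \<restriction> X)" if "X \<subseteq> verts G" for X
    proof -
      interpret X: graph "G \<restriction> X" using that by (rule induced_graph)
      show ?thesis
        using X.nomulti_digraph two_K2_free_induce[OF free] by (rule two_K2_free_imp_H_free)
    qed
    have "two_K2_free rest"
      using two_K2_free_induce[OF free] by (simp add: delete_verts_def)
    then have ?one
      by (rule rest.two_K2_free_imp_at_most_one_nontrivial_component)
    moreover have ?rest_H
      using H G1_sub separator_subset by (metis Diff_subset Un_least order_trans)
    moreover have ?triv
      using trivial_component_universal by blast
    moreover have ?edge
      using component_edge_universal[OF free] by (auto simp: nontrivial_component_def)
    moreover have ?sep
      using sep.two_K2_free_imp_at_most_one_nontrivial_component[OF two_K2_free_induce[OF free]] ..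
    moreover have ?sep_H
      using H S1_sub separator_subset by (meson order_trans)
    moreover have ?M
    proof (intro allI impI, elim conjE)
      fix S1 G1 u v
      assume S1: "nontrivial_component S1 (G \<restriction> S)" and G1: "nontrivial_component G1 rest"
        and uv: "u \<rightarrow>\<^bsub>S1\<^esub> v" and ne: "S - (neighbours G u \<union> neighbours G v) \<noteq> {}"
      have "u \<in> S" "v \<in> S" "u \<rightarrow>\<^bsub>G\<^esub> v"
        using uv S1 sep.component_dominates_iff
        by (auto simp: nontrivial_component_def dominates_induce_iff)
      moreover have "verts G1 \<inter> S = {}"
        using G1_sub[OF G1] by blast
      ultimately show "edge_universal G u v (M_set G (verts G1) S u v)"
        using separator_edge_universal[OF free] ne by blast
    qed
    ultimately show "(?one \<and> ?rest_H) \<and> ?triv \<and> ?edge \<and> (?sep \<and> ?sep_H) \<and> ?M"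
      by blast
  next
    assume conds: "(?one \<and> ?rest_H) \<and> ?triv \<and> ?edge \<and> (?sep \<and> ?sep_H) \<and> ?M"
    have sep_free: "two_K2_free (G \<restriction> S)"
    proof (rule sep.two_K2_free_if_nontrivial_components_free)
      show "at_most_one_nontrivial_component (G \<restriction> S)"
        using conds sep.connected_imp_at_most_one_nontrivial_component by blast
      fix C assume C: "nontrivial_component C (G \<restriction> S)"
      interpret C: graph C
        using induced_graph[of "verts C"] S1_sub[OF C] separator_subset S1_eq[OF C] by auto
      have "strongly_connected C"
        using C by (auto simp: nontrivial_component_def pre_digraph.sccs_def)
      moreover have "H_free C"
        using conds C S1_eq[OF C] by metis
      ultimately show "two_K2_free C"
        by (rule C.strongly_connected_H_free_imp_two_K2_free)
    qed
    show "two_K2_free G"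
    proof (rule two_K2_freeI)
      show ?one
        using conds by blast
      show "edge_universal G u v S" if "nontrivial_component C rest" "u \<rightarrow>\<^bsub>C\<^esub> v" for C u v
        using conds that by blast
      show "two_K2_free (G \<restriction> S)"
        by (rule sep_free)
      fix C assume C: "nontrivial_component C rest"
      interpret K: graph "G \<restriction> (verts C \<union> S)"
        by (rule induced_graph) (use G1_sub[OF C] separator_subset in blast)
      show "two_K2_free (G \<restriction> (verts C \<union> S))"
        using strongly_connected_with_separator C conds
          K.strongly_connected_H_free_imp_two_K2_free
        by (auto simp: nontrivial_component_def)
    qed
  qed
qed

end
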